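(* Fix $a_1,\dots,a_{d-1}\in\mathbb{Z}_{\ge 1}$ and let $M := \mathrm{lcm}\left(a_1,\dots,a_{d-1},\,-1+\sum_{i=1}^{d-1}a_i\right)$. Let $S_N\subset\mathbb{R}^d$ denote the one-row Hermite normal form simplex for these values of $a_1,\dots,a_{d-1}$ and normalized volume $N$, i.e. with non-trivial row $(a_1,\dots,a_{d-1},N)$, and let $B(S_N;z)$ be its local $h^*$-polynomial. As $N\to\infty$, the distributions for the local $h^*$-polynomials of $S_N$ converge to the distribution obtained when $N=M+1$, i.e., $$\lim_{N\to\infty}\frac{B(S_N;z)}{B(S_N;1)}=\frac{B(S_{M+1};z)}{B(S_{M+1};1)}.$$
   Context: The simplex with non-trivial row $(a_1,\dots,a_{d-1},N)$ (normalized volume $N$) is the convex hull in $\mathbb{R}^d$ of $0,e_1,\dots,e_{d-1}$ and $(a_1,\dots,a_{d-1},N)$, where $e_i$ are standard basis vectors. Let $A$ be the $(d+1)\times(d+1)$ matrix whose rows are these vertices (in this order) with an initial coordinate $1$ prepended. Put $\Lambda=\mathbb{Z}^{d+1}A^{-1}$ and $\Gamma=\Lambda/\mathbb{Z}^{d+1}$. Explicitly, the elements of $\Gamma$ are the classes of $$\ell\left(\tfrac{-1+\sum_{i=1}^{d-1} a_i}{N},-\tfrac{a_1}{N},\dots,-\tfrac{a_{d-1}}{N},\tfrac1N\right),\qquad 0\le \ell\le N-1.$$ For $x=(x_0,\dots,x_d)\in\Lambda$ let $\mathrm{age}(x)=\sum_{i=0}^d\{x_i\}$, where $\{t\}=t-\lfloor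 t\rfloor$; this depends only on the class of $x$ in $\Gamma$. The local $h^*$-polynomial is $$B(S_N;z)=\sum_{i=1}^d b_iz^i=\sum_{x} z^{\mathrm{age}(x)},$$ the sum over those $x\in\Gamma$ whose representative in $[0,1)^{d+1}$ lies in $(0,1)^{d+1}$ (i.e. no coordinate is an integer). The distribution associated to a polynomial $f$ with non-negative real coefficients is the one defined by the coefficients of $f(z)/f(1)$. *)

theory Defs
  imports
    "HOL-Computational_Algebra.Polynomial"
    "Jordan_Normal_Form.Matrix"
    "Jordan_Normal_Form.Gauss_Jordan_Elimination"
begin

text \<open>
  A lattice simplex is given by the list of its vertices. Points of \<open>\<real>\<^sup>d\<close> are elements of
  \<open>carrier_vec d\<close>, with coordinates indexed from \<open>0\<close>.
\<close>

text \<open>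
  For \<open>a = [a\<^sub>1, \<dots>, a\<^sub>d\<^sub>-\<^sub>1]\<close> the vertices are \<open>0, e\<^sub>1, \<dots>, e\<^sub>d\<^sub>-\<^sub>1, (a\<^sub>1, \<dots>, a\<^sub>d\<^sub>-\<^sub>1, N)\<close>, so
  \<open>d = length a + 1\<close>; the vector \<open>e\<^sub>i\<close> is \<open>unit_vec d (i - 1)\<close>.
\<close>

definition hnf_simplex :: "int list \<Rightarrow> int \<Rightarrow> real vec list" where
  "hnf_simplex a N =
     (let d = length a + 1
      in 0\<^sub>v d # map (unit_vec d) [0..<d - 1] @ [vec_of_list (map of_int (a @ [N]))])"

definition vertex_matrix :: "real vec list \<Rightarrow> real mat" where
  "vertex_matrix vs = mat_of_rows (length vs) (map (vCons 1) vs)"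

definition int_vecs :: "nat \<Rightarrow> real vec set" where
  "int_vecs n = {y \<in> carrier_vec n. \<forall>i<n. y $ i \<in> \<int>}"

text \<open>
  \<open>\<Lambda> = \<int>\<^sup>d\<^sup>+\<^sup>1 A\<^sup>-\<^sup>1\<close>. The row vector \<open>y A\<^sup>-\<^sup>1\<close> is written as the transpose of \<open>A\<^sup>-\<^sup>1\<close> applied to \<open>y\<close>.
  The definition is meaningful only if the vertices are affinely independent, because otherwise
  \<open>mat_inverse\<close> returns \<open>None\<close>.
\<close>

definition Lambda :: "real vec list \<Rightarrow> real vec set" where
  "Lambda vs =
     (\<lambda>y. transpose_mat (the (mat_inverse (vertex_matrix vs))) *\<^sub>v y) ` int_vecs (length vs)"

definition Gamma :: "real vec list \<Rightarrow> real vec set set" where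
  "Gamma vs =
     Lambda vs // {(x, y). x \<in> Lambda vs \<and> y \<in> Lambda vs \<and> x - y \<in> int_vecs (length vs)}"

definition age :: "real vec \<Rightarrow> real" where
  "age x = (\<Sum>i<dim_vec x. frac (x $ i))"

definition box_rep :: "real vec set \<Rightarrow> real vec" where
  "box_rep X = (THE x. x \<in> X \<and> (\<forall>i<dim_vec x. 0 \<le> x $ i \<and> x $ i < 1))"

text \<open>
  The age of an element of \<open>\<Lambda>\<close> is a natural number, because the first column of the vertex matrix
  is constantly \<open>1\<close> and hence the coordinates of such an element add up to an integer. So
  \<open>nat \<lfloor>\<dots>\<rfloor>\<close> below only changes the type.
\<close>

definition local_hstar :: "real vec list \<Rightarrow> real poly" where
  "local_hstar vs =
     (\<Sum>X | X \<in> Gamma vs \<and> (\<forall>i<length vs. 0 < box_rep X $ i \<and> box_rep X $ i < 1).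
        monom 1 (nat \<lfloor>age (box_rep X)\<rfloor>))"

text \<open>
  The polynomial \<open>f(z) / f(1)\<close>, whose coefficients are the distribution associated to \<open>f\<close>.
  For \<open>f(1) = 0\<close> this is the zero polynomial.
\<close>

definition distribution_poly :: "real poly \<Rightarrow> real poly" where
  "distribution_poly f = Polynomial.smult (1 / poly f 1) f"

end

theory Submission
  imports Defs "Jordan_Normal_Form.Determinant"
begin

text \<open>
  Let \<open>c\<close> be the list of weights \<open>-1 + \<Sum>a\<^sub>i, -a\<^sub>1, \<dots>, -a\<^sub>d\<^sub>-\<^sub>1, 1\<close>, which add up to \<open>0\<close>. The box point with
  parameter \<open>t = l/N\<close> has coordinates \<open>frac (c\<^sub>i t)\<close>, hence age \<open>-\<Sum>\<lfloor>c\<^sub>i t\<rfloor>\<close>. Every \<open>c\<^sub>i\<close> divides \<open>M\<close>, so on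
  each open cell \<open>(k/M, (k+1)/M)\<close> no \<open>c\<^sub>i t\<close> is an integer and the age is constant. A cell contains
  \<open>N/M + O(1)\<close> of the points \<open>l/N\<close>, and at most \<open>M\<close> of them lie on cell boundaries, so in the limit
  all cells carry the same mass. For \<open>N = M + 1\<close> each cell contains exactly one point, and the only
  point on a boundary is the non-interior \<open>0\<close>, so the limit is already attained there. If \<open>-1 + \<Sum>a\<^sub>i = 0\<close>, then
  \<open>M = 0\<close> and all the polynomials vanish.
\<close>

section \<open>Weights, and invertibility of the vertex matrix\<close>

definition weights :: "int list \<Rightarrow> int list" where
  "weights a = (-1 + sum_list a) # map uminus a @ [1]"

lemma length_weights [simp]: "length (weights a) = length a + 2"
  by (simp add: weights_def)

text \<open>The entry \<open>-1 + sum_list a\<close> cancels the remaining entries. This relation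
  makes ages integral and determines coordinate \<open>0\<close> of a lattice point modulo 1 from
  the others.\<close>

lemma sum_weights: "(\<Sum>i<length a + 2. weights a ! i) = 0"
proof -
  have "sum_list (weights a) = 0"
    using uminus_sum_list_map[of "\<lambda>x. x" a] by (simp add: weights_def o_def)
  then show ?thesis
    by (simp add: sum_list_sum_nth atLeast0LessThan)
qed

lemma length_hnf_simplex [simp]: "length (hnf_simplex a N) = length a + 2"
  by (simp add: hnf_simplex_def Let_def)

lemma vertex_matrix_carrier:
  "vertex_matrix (hnf_simplex a N) \<in> carrier_mat (length a + 2) (length a + 2)"
  by (auto simp: vertex_matrix_def)

lemma vertex_matrix_entry:
  assumes "i < length a + 2" "j < length a + 2"
  shows "vertex_matrix (hnf_simplex a N) $$ (i, j) =
    (if j = 0 then 1 else if i < length a + 1 then (if i = j then 1 else 0)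
     else of_int ((a @ [N]) ! (j - 1)))"
proof -
  have *: "vertex_matrix (hnf_simplex a N) $$ (i, j) =
      (if j = 0 then 1 else (hnf_simplex a N ! i) $ (j - 1))"
    using assms by (simp add: vertex_matrix_def mat_of_rows_index vec_index_vCons)
  consider "i = 0" | "0 < i" "i < length a + 1" | "i = length a + 1"
    using assms by linarith
  then show ?thesis
  proof cases
    case 1
    then show ?thesis using * assms by (auto simp: hnf_simplex_def Let_def)
  next
    case 2
    then have "hnf_simplex a N ! i = unit_vec (length a + 1) (i - 1)"
      by (auto simp: hnf_simplex_def Let_def nth_append nth_Cons')
    then show ?thesis using * assms 2 by auto
  next
    case 3
    then have "hnf_simplex a N ! i = vec_of_list (map of_int (a @ [N]))"
      by (auto simp: hnf_simplex_def Let_def nth_append)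
    then have "j \<noteq> 0 \<Longrightarrow> (hnf_simplex a N ! i) $ (j - 1) = map real_of_int (a @ [N]) ! (j - 1)"
      using vec_of_list_index by metis
    moreover have "j \<noteq> 0 \<Longrightarrow> j - 1 < length (a @ [N])" using assms by simp
    ultimately show ?thesis using * 3 by (metis (no_types) nth_map less_irrefl)
  qed
qed

text \<open>The matrix is lower triangular with diagonal \<open>1, ..., 1, N\<close>, so its
  determinant is \<open>N\<close>. This excludes the \<open>None\<close> case of
  \<open>mat_inverse\<close>.\<close>

lemma vertex_matrix_inverse:
  assumes "N \<noteq> 0"
  obtains B where "mat_inverse (vertex_matrix (hnf_simplex a N)) = Some B"
    "B \<in> carrier_mat (length a + 2) (length a + 2)"
    "vertex_matrix (hnf_simplex a N) * B = 1\<^sub>m (length a + 2)"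
    "B * vertex_matrix (hnf_simplex a N) = 1\<^sub>m (length a + 2)"
proof -
  let ?A = "vertex_matrix (hnf_simplex a N)" and ?n = "length a + 2"
  have "det ?A = prod_list (diag_mat ?A)"
    by (rule det_lower_triangular[OF _ vertex_matrix_carrier]) (auto simp: vertex_matrix_entry)
  also have "\<dots> = (\<Prod>i<?n. ?A $$ (i, i))"
    using vertex_matrix_carrier[of a N] by (simp add: prod_list_diag_prod atLeast0LessThan)
  also have "\<dots> \<noteq> 0"
    using assms by (auto simp: vertex_matrix_entry nth_append)
  finally have "?A \<in> Units (ring_mat TYPE(real) ?n ())"
    by (rule det_non_zero_imp_unit[OF vertex_matrix_carrier])
  then obtain B where "mat_inverse ?A = Some B"
    using mat_inverse(1)[OF vertex_matrix_carrier, of a N "()"] by (cases "mat_inverse ?A") blast+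
  then show ?thesis
    using mat_inverse(2)[OF vertex_matrix_carrier] that by blast
qed

section \<open>The lattice \<open>Lambda\<close> described by congruences\<close>

text \<open>Multiplying a row vector \<open>x = y A^-1\<close> by \<open>A\<close> recovers
  \<open>y\<close>, so \<open>x\<close> lies in the lattice exactly when \<open>x A\<close> is
  integral. The inverse matrix is no longer needed after this.\<close>

lemma Lambda_hnf_simplex_iff:
  assumes "N \<noteq> 0"
  shows "x \<in> Lambda (hnf_simplex a N) \<longleftrightarrow> x \<in> carrier_vec (length a + 2) \<and>
    transpose_mat (vertex_matrix (hnf_simplex a N)) *\<^sub>v x \<in> int_vecs (length a + 2)"
proof -
  let ?A = "vertex_matrix (hnf_simplex a N)" and ?n = "length a + 2"
  obtain B where B: "mat_inverse ?A = Some B" "B \<in> carrier_mat ?n ?n"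
    "?A * B = 1\<^sub>m ?n" "B * ?A = 1\<^sub>m ?n"
    using vertex_matrix_inverse[OF assms] by metis
  have A: "?A \<in> carrier_mat ?n ?n" by (rule vertex_matrix_carrier)
  have AB: "transpose_mat ?A * transpose_mat B = 1\<^sub>m ?n" "transpose_mat B * transpose_mat ?A = 1\<^sub>m ?n"
    using B A transpose_mult[of B ?n ?n ?A ?n] transpose_mult[of ?A ?n ?n B ?n] transpose_one[of ?n, where ?'a = real]
    by simp_all
  have L: "Lambda (hnf_simplex a N) = (*\<^sub>v) (transpose_mat B) ` int_vecs ?n"
    by (simp add: Lambda_def B)
  show ?thesis
  proof
    assume "x \<in> Lambda (hnf_simplex a N)"
    then obtain y where y: "y \<in> int_vecs ?n" "x = transpose_mat B *\<^sub>v y" by (auto simp: L)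
    then have yc: "y \<in> carrier_vec ?n" by (simp add: int_vecs_def)
    have "transpose_mat ?A *\<^sub>v x = y"
      using assoc_mult_mat_vec[of "transpose_mat ?A" ?n ?n "transpose_mat B" ?n y] A B(2) yc AB y
      by simp
    then show "x \<in> carrier_vec ?n \<and> transpose_mat ?A *\<^sub>v x \<in> int_vecs ?n"
      using y yc B(2) mult_mat_vec_carrier[of "transpose_mat B" ?n ?n y] by simp
  next
    assume *: "x \<in> carrier_vec ?n \<and> transpose_mat ?A *\<^sub>v x \<in> int_vecs ?n"
    have "x = transpose_mat B *\<^sub>v (transpose_mat ?A *\<^sub>v x)"
      using assoc_mult_mat_vec[of "transpose_mat B" ?n ?n "transpose_mat ?A" ?n x] A B(2) * AB
      by simp
    then show "x \<in> Lambda (hnf_simplex a N)" using * L by blast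
  qed
qed

lemma transpose_vertex_matrix_mult:
  assumes "x \<in> carrier_vec (length a + 2)" "j < length a + 2"
  shows "(transpose_mat (vertex_matrix (hnf_simplex a N)) *\<^sub>v x) $ j =
    (if j = 0 then \<Sum>i<length a + 2. x $ i
     else if j < length a + 1 then x $ j + of_int (a ! (j - 1)) * x $ (length a + 1)
     else N * x $ (length a + 1))"
proof -
  let ?A = "vertex_matrix (hnf_simplex a N)"
  have A: "?A \<in> carrier_mat (length a + 2) (length a + 2)" by (rule vertex_matrix_carrier)
  have "(transpose_mat ?A *\<^sub>v x) $ j = (\<Sum>i<length a + 2. ?A $$ (i, j) * x $ i)"
    using assms A by (auto simp: scalar_prod_def atLeast0LessThan intro!: sum.cong)
  also have "\<dots> = (\<Sum>i<length a + 1. ?A $$ (i, j) * x $ i) + ?A $$ (length a + 1, j) * x $ (length a + 1)"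
    by simp
  also have "(\<Sum>i<length a + 1. ?A $$ (i, j) * x $ i) =
    (\<Sum>i<length a + 1. if j = 0 then x $ i else if i = j then x $ i else 0)"
    using assms by (intro sum.cong) (auto simp: vertex_matrix_entry)
  finally show ?thesis
    using assms by (auto simp: vertex_matrix_entry nth_append)
qed

text \<open>Integrality of the last coordinate of \<open>x A\<close> produces \<open>l\<close>, the
  middle coordinates then fix the middle entries of \<open>x\<close> modulo 1, and coordinate
  \<open>0\<close>, the sum of all entries, fixes \<open>x $ 0\<close> because the weights add up to
  0.\<close>

lemma Lambda_hnf_simplex:
  assumes "N \<noteq> 0"
  shows "Lambda (hnf_simplex a N) = {x \<in> carrier_vec (length a + 2).
    \<exists>l::int. \<forall>i<length a + 2. x $ i - of_int (weights a ! i) * (l / N) \<in> \<int>}" (is "_ = ?R")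
proof (rule Set.set_eqI)
  fix x
  let ?n = "length a + 2" and ?A = "transpose_mat (vertex_matrix (hnf_simplex a N))"
  let ?y = "\<lambda>(l::int) i. x $ i - of_int (weights a ! i) * (l / N)"
  have w_last: "weights a ! Suc (length a) = 1"
    by (simp add: weights_def nth_append)
  have w_mid: "weights a ! j = - (a ! (j - 1))" if "0 < j" "j < length a + 1" for j
    using that by (auto simp: weights_def nth_append nth_Cons')
  have sum_y: "(\<Sum>i<?n. ?y l i) = (\<Sum>i<?n. x $ i)" for l
  proof -
    have "(\<Sum>i<?n. ?y l i) = (\<Sum>i<?n. x $ i) - of_int (\<Sum>i<?n. weights a ! i) * (l / N)"
      unfolding sum_subtractf of_int_sum sum_distrib_right ..
    then show ?thesis unfolding sum_weights by simp
  qed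
  have split_y: "(\<Sum>i<?n. ?y l i) = ?y l 0 + (\<Sum>i\<in>{0<..<?n}. ?y l i)" for l
  proof -
    have "{..<?n} = insert 0 {0<..<?n}" by auto
    then show ?thesis by simp
  qed
  show "x \<in> Lambda (hnf_simplex a N) \<longleftrightarrow> x \<in> ?R"
  proof
    assume "x \<in> Lambda (hnf_simplex a N)"
    then have x: "x \<in> carrier_vec ?n" and *: "\<And>j. j < ?n \<Longrightarrow> (?A *\<^sub>v x) $ j \<in> \<int>"
      using Lambda_hnf_simplex_iff[OF assms] by (auto simp: int_vecs_def)
    have "N * x $ (length a + 1) \<in> \<int>"
      using *[of "length a + 1"] transpose_vertex_matrix_mult[OF x, of "length a + 1" N] by simp
    then obtain l :: int where l: "N * x $ (length a + 1) = l" by (auto elim: Ints_cases)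
    then have xl: "x $ (length a + 1) = l / N" using assms by (simp add: field_simps)
    have pos: "?y l j \<in> \<int>" if "0 < j" "j < ?n" for j
    proof (cases "j < length a + 1")
      case True
      then show ?thesis
        using *[of j] transpose_vertex_matrix_mult[OF x, of j N] that xl w_mid[of j] by simp
    next
      case False
      then have "j = length a + 1" using that by simp
      then show ?thesis using xl w_last by simp
    qed
    have "?y l 0 = (\<Sum>i<?n. x $ i) - (\<Sum>i\<in>{0<..<?n}. ?y l i)"
      using sum_y[of l] split_y[of l] by linarith
    moreover have "(\<Sum>i<?n. x $ i) \<in> \<int>"
      using *[of 0] transpose_vertex_matrix_mult[OF x, of 0 N] by simp
    moreover have "(\<Sum>i\<in>{0<..<?n}. ?y l i) \<in> \<int>"
      using pos by (intro Ints_sum) auto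
    ultimately have "?y l 0 \<in> \<int>" by (simp only: Ints_diff)
    then have "?y l i \<in> \<int>" if "i < ?n" for i
      using pos[of i] that by (cases "i = 0") simp_all
    then show "x \<in> ?R" using x by blast
  next
    assume "x \<in> ?R"
    then obtain l :: int where x: "x \<in> carrier_vec ?n" and l: "\<And>i. i < ?n \<Longrightarrow> ?y l i \<in> \<int>"
      by blast
    have last: "x $ (length a + 1) - l / N \<in> \<int>"
      using l[of "length a + 1"] w_last by simp
    have "(?A *\<^sub>v x) $ j \<in> \<int>" if j: "j < ?n" for j
    proof -
      consider "j = 0" | "0 < j" "j < length a + 1" | "j = length a + 1"
        using j by linarith
      then show ?thesis
      proof cases
        case 1
        have "(\<Sum>i<?n. ?y l i) \<in> \<int>" using l by (intro Ints_sum) auto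
        then have "(\<Sum>i<?n. x $ i) \<in> \<int>" unfolding sum_y .
        then show ?thesis
          using 1 transpose_vertex_matrix_mult[OF x j] by simp
      next
        case 2
        \<comment> \<open>Here \<open>x $ (length a + 1)\<close> agrees with \<open>l / N\<close>
          only modulo 1, hence the correction term.\<close>
        have "x $ j + of_int (a ! (j - 1)) * x $ (length a + 1) =
            ?y l j + of_int (a ! (j - 1)) * (x $ (length a + 1) - l / N)"
          using w_mid[OF 2] by (simp add: algebra_simps)
        also have "\<dots> \<in> \<int>" by (intro Ints_add Ints_mult last l j Ints_of_int)
        finally show ?thesis using 2 transpose_vertex_matrix_mult[OF x j, of N] by simp
      next
        case 3
        have "N * x $ (length a + 1) = N * (x $ (length a + 1) - l / N) + l"
          using assms by (simp add: field_simps)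
        also have "\<dots> \<in> \<int>" by (intro Ints_add Ints_mult last Ints_of_int)
        finally show ?thesis using 3 transpose_vertex_matrix_mult[OF x j, of N] by simp
      qed
    qed
    then show "x \<in> Lambda (hnf_simplex a N)"
      using x mult_mat_vec_carrier[of ?A ?n ?n x] vertex_matrix_carrier[of a N]
      by (simp add: Lambda_hnf_simplex_iff[OF assms] int_vecs_def)
  qed
qed

section \<open>The quotient \<open>Gamma\<close> and its box representatives\<close>

text \<open>This is the element of \<open>Gamma\<close> given by \<open>l\<close> times the
  generator, for any integer \<open>l\<close>; the restriction to \<open>0 \<le> l < N\<close> comes
  later.\<close>

definition coset :: "int list \<Rightarrow> int \<Rightarrow> int \<Rightarrow> real vec set" where
  "coset a N l = {x \<in> carrier_vec (length a + 2).
     \<forall>i<length a + 2. x $ i - of_int (weights a ! i) * (l / N) \<in> \<int>}"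

lemma Lambda_eq_UN_coset:
  assumes "N \<noteq> 0"
  shows "Lambda (hnf_simplex a N) = (\<Union>l. coset a N l)"
  by (auto simp: Lambda_hnf_simplex[OF assms] coset_def)

lemma coset_class:
  assumes "N \<noteq> 0" "x \<in> coset a N l"
  shows "{(x, y). x \<in> Lambda (hnf_simplex a N) \<and> y \<in> Lambda (hnf_simplex a N) \<and>
    x - y \<in> int_vecs (length (hnf_simplex a N))} `` {x} = coset a N l"
proof (rule Set.set_eqI)
  fix y
  let ?n = "length a + 2"
  have x: "x \<in> carrier_vec ?n" "x \<in> Lambda (hnf_simplex a N)"
      "\<And>i. i < ?n \<Longrightarrow> x $ i - of_int (weights a ! i) * (l / N) \<in> \<int>"
    using assms by (auto simp: Lambda_eq_UN_coset coset_def)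
  have eq: "x - y \<in> int_vecs ?n \<longleftrightarrow> y \<in> coset a N l" if y: "y \<in> carrier_vec ?n"
  proof -
    have "x $ i - y $ i \<in> \<int> \<longleftrightarrow> y $ i - of_int (weights a ! i) * (l / N) \<in> \<int>" if "i < ?n" for i
    proof -
      have "y $ i - of_int (weights a ! i) * (l / N) =
          (x $ i - of_int (weights a ! i) * (l / N)) - (x $ i - y $ i)"
        "x $ i - y $ i = (x $ i - of_int (weights a ! i) * (l / N)) -
          (y $ i - of_int (weights a ! i) * (l / N))" by simp_all
      then show ?thesis using x(3)[OF that] Ints_diff by metis
    qed
    then show ?thesis using x(1) y by (auto simp: int_vecs_def coset_def)
  qed
  show "y \<in> {(x, y). x \<in> Lambda (hnf_simplex a N) \<and> y \<in> Lambda (hnf_simplex a N) \<and>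
      x - y \<in> int_vecs (length (hnf_simplex a N))} `` {x} \<longleftrightarrow> y \<in> coset a N l" (is "?L \<longleftrightarrow> _")
  proof
    assume ?L
    then have "y \<in> Lambda (hnf_simplex a N)" "x - y \<in> int_vecs ?n" by simp_all
    then show "y \<in> coset a N l"
      using eq by (auto simp: Lambda_hnf_simplex[OF assms(1)])
  next
    assume *: "y \<in> coset a N l"
    then have "y \<in> carrier_vec ?n" by (simp add: coset_def)
    with * eq have "x - y \<in> int_vecs ?n" by blast
    moreover have "y \<in> Lambda (hnf_simplex a N)" using * Lambda_eq_UN_coset[OF assms(1)] by blast
    ultimately show ?L using x(2) by simp
  qed
qed

text \<open>Changing \<open>l\<close> by a multiple of \<open>N\<close> shifts every coordinate of
  \<open>l / N\<close> times the weights by an integer.\<close>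

lemma coset_mod:
  assumes "N \<noteq> 0"
  shows "coset a N (l mod N) = coset a N l"
proof -
  have "y - of_int c * ((l mod N) / N) \<in> \<int> \<longleftrightarrow> y - of_int c * (l / N) \<in> \<int>" for y :: real and c :: int
  proof -
    have "real_of_int l / N = of_int (l div N * N + l mod N) / N" by (simp only: div_mult_mod_eq)
    also have "\<dots> = of_int (l div N) + of_int (l mod N) / N"
      using assms unfolding of_int_add of_int_mult add_divide_distrib by simp
    finally have "y - of_int c * (l / N) = (y - of_int c * ((l mod N) / N)) - of_int (c * (l div N))"
      by (simp add: algebra_simps)
    then show ?thesis
      by (metis Ints_of_int Ints_diff Ints_add diff_add_cancel)
  qed
  then show ?thesis by (simp add: coset_def)
qed

definition box_point :: "int list \<Rightarrow> int \<Rightarrow> int \<Rightarrow> real vec" where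
  "box_point a N l = vec (length a + 2) (\<lambda>i. frac (of_int (weights a ! i) * (l / N)))"

lemma box_point_in_coset: "box_point a N l \<in> coset a N l"
  by (auto simp: box_point_def coset_def frac_def)

text \<open>Each coordinate is prescribed modulo 1, and \<open>frac\<close> is the only choice in
  \<open>[0,1)\<close>; this resolves the definite description.\<close>

lemma box_rep_coset: "box_rep (coset a N l) = box_point a N l"
  unfolding box_rep_def
proof (rule the_equality)
  show "box_point a N l \<in> coset a N l \<and>
      (\<forall>i<dim_vec (box_point a N l). 0 \<le> box_point a N l $ i \<and> box_point a N l $ i < 1)"
    using box_point_in_coset by (auto simp: box_point_def frac_lt_1)
next
  fix x assume x: "x \<in> coset a N l \<and> (\<forall>i<dim_vec x. 0 \<le> x $ i \<and> x $ i < 1)"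
  then have dim: "dim_vec x = length a + 2" by (auto simp: coset_def)
  show "x = box_point a N l"
  proof (rule eq_vecI)
    fix i assume "i < dim_vec (box_point a N l)"
    then have i: "i < length a + 2" by (simp add: box_point_def)
    have "of_int (weights a ! i) * (l / N) - x $ i \<in> \<int>"
      using x i Ints_minus[of "x $ i - of_int (weights a ! i) * (l / N)"] by (auto simp: coset_def)
    then have "frac (of_int (weights a ! i) * (l / N)) = x $ i"
      using x i dim by (subst frac_unique_iff) auto
    then show "x $ i = box_point a N l $ i" using i by (simp add: box_point_def)
  qed (simp add: dim box_point_def)
qed

lemma Gamma_hnf_simplex:
  assumes "N > 0"
  shows "Gamma (hnf_simplex a N) = coset a N ` {0..<N}"
proof -
  have N: "N \<noteq> 0" using assms by simp
  have "X \<in> Gamma (hnf_simplex a N) \<longleftrightarrow> X \<in> range (coset a N)" for X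
  proof -
    have "X \<in> Gamma (hnf_simplex a N) \<longleftrightarrow> (\<exists>x\<in>Lambda (hnf_simplex a N).
      X = {(x, y). x \<in> Lambda (hnf_simplex a N) \<and> y \<in> Lambda (hnf_simplex a N) \<and>
        x - y \<in> int_vecs (length (hnf_simplex a N))} `` {x})"
      unfolding Gamma_def quotient_def by (simp only: UN_iff singleton_iff)
    also have "\<dots> \<longleftrightarrow> (\<exists>l. \<exists>x\<in>coset a N l.
      X = {(x, y). x \<in> Lambda (hnf_simplex a N) \<and> y \<in> Lambda (hnf_simplex a N) \<and>
        x - y \<in> int_vecs (length (hnf_simplex a N))} `` {x})"
      using Lambda_eq_UN_coset[OF N, of a] by blast
    also have "\<dots> \<longleftrightarrow> (\<exists>l. \<exists>x\<in>coset a N l. X = coset a N l)"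
      using coset_class[OF N] by (intro ex_cong1 bex_cong) simp_all
    also have "\<dots> \<longleftrightarrow> (\<exists>l. X = coset a N l)"
      using box_point_in_coset by (intro ex_cong1) auto
    finally show ?thesis by (simp only: image_iff UNIV_I bex_UNIV)
  qed
  then have "Gamma (hnf_simplex a N) = range (coset a N)"
    by (rule Set.set_eqI)
  also have "\<dots> = coset a N ` {0..<N}"
  proof -
    have "coset a N l \<in> coset a N ` {0..<N}" for l
      using assms coset_mod[OF N, of a l] by (intro image_eqI[of _ _ "l mod N"]) auto
    then show ?thesis by auto
  qed
  finally show ?thesis .
qed

text \<open>The last weight is 1, so the last coordinate of the box point is \<open>l / N\<close>
  itself and determines \<open>l\<close>.\<close>

lemma inj_on_coset:
  assumes "N > 0"
  shows "inj_on (coset a N) {0..<N}"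
proof (rule inj_onI)
  fix l l' assume l: "l \<in> {0..<N}" "l' \<in> {0..<N}" and eq: "coset a N l = coset a N l'"
  then have "box_point a N l $ (length a + 1) = box_point a N l' $ (length a + 1)"
    using box_rep_coset by metis
  then have "frac (l / N) = frac (l' / N)"
    by (simp add: box_point_def weights_def nth_append)
  then have "real_of_int l / N = l' / N"
    using l by (simp add: frac_eq[THEN iffD2])
  then show "l = l'" using assms by simp
qed

section \<open>The local h*-polynomial as a sum over parameters\<close>

text \<open>Interiority and age are made functions of the real parameter \<open>t = l / N\<close>,
  so that box points for different \<open>N\<close> can be compared.\<close>

definition interior_param :: "int list \<Rightarrow> real \<Rightarrow> bool" where
  "interior_param a t \<longleftrightarrow> (\<forall>c\<in>set (weights a). of_int c * t \<notin> \<int>)"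

definition age_at :: "int list \<Rightarrow> real \<Rightarrow> nat" where
  "age_at a t = nat \<lfloor>\<Sum>i<length a + 2. frac (of_int (weights a ! i) * t)\<rfloor>"

lemma local_hstar_hnf_simplex:
  assumes "N > 0"
  shows "local_hstar (hnf_simplex a N) =
    (\<Sum>l::int | l \<in> {0..<N} \<and> interior_param a (l / N). monom 1 (age_at a (l / N)))"
proof -
  let ?I = "{l::int. l \<in> {0..<N} \<and> interior_param a (l / N)}"
  have int: "(\<forall>i<length a + 2. 0 < box_point a N l $ i \<and> box_point a N l $ i < 1) \<longleftrightarrow>
      interior_param a (l / N)" for l
  proof -
    have "interior_param a (l / N) \<longleftrightarrow> (\<forall>i<length (weights a). of_int (weights a ! i) * (l / N) \<notin> \<int>)"
      unfolding interior_param_def all_set_conv_all_nth ..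
    then show ?thesis by (simp add: box_point_def frac_lt_1 frac_gt_0_iff)
  qed
  have age: "nat \<lfloor>age (box_point a N l)\<rfloor> = age_at a (l / N)" for l
    by (simp add: age_def age_at_def box_point_def)
  have "{X \<in> Gamma (hnf_simplex a N).
      \<forall>i<length (hnf_simplex a N). 0 < box_rep X $ i \<and> box_rep X $ i < 1} = coset a N ` ?I"
    by (auto simp: Gamma_hnf_simplex[OF assms] box_rep_coset int simp flip: int)
  moreover have "inj_on (coset a N) ?I"
    by (rule inj_on_subset[OF inj_on_coset[OF assms]]) auto
  ultimately show ?thesis
    unfolding local_hstar_def by (simp only: sum.reindex o_def box_rep_coset age)
qed

text \<open>Powers of \<open>z\<close> as \<open>w\<close> give values of the polynomial, indicators
  give its coefficients, and the constant 1 gives the normalizing factor. One limit statement for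
  arbitrary \<open>w\<close> thus covers both notions of convergence.\<close>

definition box_sum :: "int list \<Rightarrow> (nat \<Rightarrow> real) \<Rightarrow> int \<Rightarrow> real" where
  "box_sum a w N = (\<Sum>l::int | l \<in> {0..<N} \<and> interior_param a (l / N). w (age_at a (l / N)))"

lemma poly_local_hstar:
  "N > 0 \<Longrightarrow> poly (local_hstar (hnf_simplex a N)) z = box_sum a (\<lambda>j. z ^ j) N"
  by (simp add: local_hstar_hnf_simplex box_sum_def poly_sum poly_monom)

lemma coeff_local_hstar:
  "N > 0 \<Longrightarrow> coeff (local_hstar (hnf_simplex a N)) i = box_sum a (\<lambda>j. of_bool (j = i)) N"
  by (simp add: local_hstar_hnf_simplex box_sum_def coeff_sum of_bool_def)

section \<open>Constancy of the age on cells\<close>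

text \<open>In the sum of the fractional parts the terms linear in \<open>t\<close> cancel, since
  the weights add up to 0. What remains is an integer, so the outer floor disappears.\<close>

lemma age_at_eq: "age_at a t = nat (- (\<Sum>i<length a + 2. \<lfloor>of_int (weights a ! i) * t\<rfloor>))"
proof -
  have "(\<Sum>i<length a + 2. frac (of_int (weights a ! i) * t)) =
      of_int (\<Sum>i<length a + 2. weights a ! i) * t -
      of_int (\<Sum>i<length a + 2. \<lfloor>of_int (weights a ! i) * t\<rfloor>)"
    unfolding frac_def sum_subtractf of_int_sum sum_distrib_right ..
  also have "\<dots> = of_int (- (\<Sum>i<length a + 2. \<lfloor>of_int (weights a ! i) * t\<rfloor>))"
    unfolding sum_weights by simp
  finally show ?thesis unfolding age_at_def by (simp only: floor_of_int)
qed

lemma dvd_mult_Ints: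
  fixes c M :: int and t :: real
  assumes "c dvd M" "of_int c * t \<in> \<int>"
  shows "of_int M * t \<in> \<int>"
proof -
  obtain q where "M = q * c" using assms(1) by (metis dvd_def mult.commute)
  then have "of_int M * t = of_int q * (of_int c * t)" by simp
  then show ?thesis using assms(2) by (metis Ints_mult Ints_of_int)
qed

text \<open>If the floors differed, an integer \<open>m\<close> would separate \<open>c * t\<close>
  from \<open>c * t'\<close>. With \<open>M = q * c\<close>, the integer \<open>q * m\<close> would
  then lie strictly between \<open>k\<close> and \<open>k + 1\<close>.\<close>

lemma floor_mult_cell:
  fixes c M k :: int and t t' :: real
  assumes "c dvd M" "M > 0"
    and t: "k < M * t" "M * t < k + 1" and t': "k < M * t'" "M * t' < k + 1"
  shows "\<lfloor>c * t\<rfloor> = \<lfloor>c * t'\<rfloor>"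
proof -
  have le: "\<lfloor>c * u\<rfloor> \<le> \<lfloor>c * t\<rfloor>"
    if t: "k < M * t" "M * t < k + 1" and u: "k < M * u" "M * u < k + 1" for t u :: real
  proof (rule ccontr)
    define m where "m = \<lfloor>c * u\<rfloor>"
    assume "\<not> ?thesis"
    then have m: "c * t < m" "m \<le> c * u"
      unfolding m_def by (simp_all add: floor_less_iff not_le)
    obtain q where q: "M = q * c" using assms(1) by (metis dvd_def mult.commute)
    have "M * t = q * (c * t)" "M * u = q * (c * u)" by (simp_all add: q)
    then have Mt: "k < q * (c * t)" "q * (c * t) < k + 1" "k < q * (c * u)" "q * (c * u) < k + 1"
      using t u by (simp_all only:)
    show False
    proof (cases "q > 0")
      case True
      then have "q * (c * t) < q * real_of_int m" "q * real_of_int m \<le> q * (c * u)"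
        using m by simp_all
      then have "real_of_int k < of_int (q * m)" "real_of_int (q * m) < of_int (k + 1)"
        unfolding of_int_mult of_int_add of_int_1 using Mt by linarith+
      then show False unfolding of_int_less_iff by simp
    next
      \<comment> \<open>Weights may be negative; then \<open>q < 0\<close> and multiplication by
        \<open>q\<close> reverses the inequalities.\<close>
      case False
      then have "q < 0" using q assms(2) by (cases "q = 0") auto
      then have "q * (c * t) > q * real_of_int m" "q * real_of_int m \<ge> q * (c * u)"
        using m by simp_all
      then have "real_of_int k < of_int (q * m)" "real_of_int (q * m) < of_int (k + 1)"
        unfolding of_int_mult of_int_add of_int_1 using Mt by linarith+
      then show False unfolding of_int_less_iff by simp
    qed
  qed
  show ?thesis using le[OF t t'] le[OF t' t] by simp
qed

lemma age_at_cell: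
  fixes M k :: int and t t' :: real
  assumes "\<forall>c\<in>set (weights a). c dvd M" "M > 0"
    and "k < M * t" "M * t < k + 1" "k < M * t'" "M * t' < k + 1"
  shows "age_at a t = age_at a t'"
proof -
  have "\<lfloor>(weights a ! i) * t\<rfloor> = \<lfloor>(weights a ! i) * t'\<rfloor>" if "i < length a + 2" for i
    using assms that nth_mem[of i "weights a"] by (intro floor_mult_cell) auto
  then show ?thesis unfolding age_at_eq by simp
qed

lemma interior_paramI:
  assumes "\<forall>c\<in>set (weights a). c dvd M" "of_int M * t \<notin> \<int>"
  shows "interior_param a t"
  using assms dvd_mult_Ints unfolding interior_param_def by blast

lemma of_int_divide_Ints_iff:
  fixes m N :: int
  assumes "N \<noteq> 0"
  shows "(of_int m / of_int N :: real) \<in> \<int> \<longleftrightarrow> N dvd m"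
proof
  assume "(of_int m / of_int N :: real) \<in> \<int>"
  then obtain j where "of_int m / of_int N = real_of_int j" by (auto elim: Ints_cases)
  then have "real_of_int m = of_int (N * j)" using assms by (simp add: field_simps)
  then show "N dvd m" unfolding of_int_eq_iff by simp
qed (use assms in auto)

text \<open>The points \<open>l/(M+1)\<close> with \<open>1 \<le> l \<le> M\<close> hit each open cell \<open>(k/M, (k+1)/M)\<close> exactly once,
  so \<open>(k+1)/(M+1)\<close> serves as representative of its cell.\<close>

lemma box_sum_Suc:
  assumes dvd: "\<forall>c\<in>set (weights a). c dvd M" and "M > 0"
  shows "box_sum a w (M + 1) = (\<Sum>k::int\<in>{0..<M}. w (age_at a (of_int (k + 1) / of_int (M + 1))))"
proof -
  have "{l. l \<in> {0..<M + 1} \<and> interior_param a (of_int l / of_int (M + 1))} = {1..<M + 1}"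
  proof (intro equalityI subsetI)
    fix l assume "l \<in> {l. l \<in> {0..<M + 1} \<and> interior_param a (of_int l / of_int (M + 1))}"
    moreover have "\<not> interior_param a 0" by (auto simp: interior_param_def weights_def)
    ultimately show "l \<in> {1..<M + 1}" by (cases "l = 0") auto
  next
    fix l assume l: "l \<in> {1..<M + 1}"
    have "\<not> (M + 1) dvd l" using l zdvd_imp_le[of "M + 1" l] by auto
    \<comment> \<open>By coprimality, \<open>M * l / (M + 1)\<close> is an integer only if
      \<open>M + 1\<close> divides \<open>l\<close>, so no point with
      \<open>1 \<le> l \<le> M\<close> lies on a cell boundary.\<close>
    moreover have "coprime (M + 1) M" by simp
    ultimately have "\<not> (M + 1) dvd (M * l)" by (simp add: coprime_dvd_mult_right_iff)
    then have "real_of_int (M * l) / of_int (M + 1) \<notin> \<int>"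
      using assms(2) by (subst of_int_divide_Ints_iff) auto
    then have "interior_param a (of_int l / of_int (M + 1))"
      by (intro interior_paramI[OF dvd]) simp
    then show "l \<in> {l. l \<in> {0..<M + 1} \<and> interior_param a (of_int l / of_int (M + 1))}" using l by simp
  qed
  then have "box_sum a w (M + 1) = (\<Sum>l\<in>{1..<M + 1}. w (age_at a (of_int l / of_int (M + 1))))"
    by (simp add: box_sum_def)
  also have "\<dots> = (\<Sum>k::int\<in>{0..<M}. w (age_at a (of_int (k + 1) / of_int (M + 1))))"
    by (rule sum.reindex_bij_witness[of _ "\<lambda>k. k + 1" "\<lambda>l. l - 1"]) auto
  finally show ?thesis .
qed

section \<open>Counting the points in each cell\<close>

text \<open>The condition \<open>k / M < l / N < (k + 1) / M\<close> with denominators cleared, for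
  positive \<open>M\<close> and \<open>N\<close>.\<close>

definition cell_points :: "int \<Rightarrow> int \<Rightarrow> int \<Rightarrow> int set" where
  "cell_points M N k = {l. k * N < M * l \<and> M * l < (k + 1) * N}"

text \<open>These are the integers in an open interval of length \<open>N / M\<close>, whose number
  differs from the length by at most 1.\<close>

lemma card_cell_points:
  assumes "M > 0" "N > 0"
  shows "\<bar>real (card (cell_points M N k)) - N / M\<bar> \<le> 1"
proof -
  define x y :: real where "x = k * N / M" and "y = (k + 1) * N / M"
  have xy: "y = x + N / M" "x < y" using assms by (simp_all add: x_def y_def field_simps)
  have "k * N < M * l \<longleftrightarrow> x < l" "M * l < (k + 1) * N \<longleftrightarrow> l < y" for l
  proof -
    have "x < l \<longleftrightarrow> real_of_int (k * N) < real_of_int (M * l)"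
      "l < y \<longleftrightarrow> real_of_int (M * l) < real_of_int ((k + 1) * N)"
      using assms by (simp_all add: x_def y_def field_simps)
    then show "k * N < M * l \<longleftrightarrow> x < l" "M * l < (k + 1) * N \<longleftrightarrow> l < y"
      unfolding of_int_less_iff by simp_all
  qed
  then have "cell_points M N k = {\<lfloor>x\<rfloor><..<\<lceil>y\<rceil>}"
    by (auto simp: cell_points_def floor_less_iff less_ceiling_iff)
  then have "card (cell_points M N k) = nat (\<lceil>y\<rceil> - (\<lfloor>x\<rfloor> + 1))" by simp
  \<comment> \<open>This keeps \<open>nat\<close> from truncating a negative difference.\<close>
  moreover have "\<lfloor>x\<rfloor> < \<lceil>y\<rceil>" using xy by linarith
  ultimately have "real (card (cell_points M N k)) = \<lceil>y\<rceil> - \<lfloor>x\<rfloor> - 1" by simp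
  then show ?thesis using xy by linarith
qed

lemma card_cell_points_limit:
  assumes "M > 0"
  shows "(\<lambda>n. card (cell_points M (int n) k) / n) \<longlonglongrightarrow> 1 / M"
proof (rule LIM_zero_cancel, rule tendsto_0_le[where K = 1])
  show "\<forall>\<^sub>F n in sequentially. norm (card (cell_points M (int n) k) / n - 1 / M) \<le> norm (1 / real n) * 1"
  proof (rule eventually_mono[OF eventually_gt_at_top[of 0]])
    fix n :: nat assume n: "n > 0"
    then have "card (cell_points M (int n) k) / n - 1 / M = (card (cell_points M (int n) k) - n / M) / n"
      by (simp add: field_simps)
    then show "norm (card (cell_points M (int n) k) / n - 1 / M) \<le> norm (1 / real n) * 1"
      using card_cell_points[OF assms, of "int n" k] n by (simp add: divide_right_mono)
  qed
  show "(\<lambda>n. 1 / real n) \<longlonglongrightarrow> 0" by (rule lim_1_over_n)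
qed

text \<open>Interior parameters inside open cells contribute the sum over \<open>k\<close>. The
  others sit at boundaries \<open>j / M\<close>, at most one for each \<open>j\<close>, so the error
  bound does not depend on \<open>N\<close>.\<close>

lemma box_sum_cells:
  fixes w :: "nat \<Rightarrow> real"
  assumes dvd: "\<forall>c\<in>set (weights a). c dvd M" and M: "M > 0" and N: "N > 0"
  shows "\<bar>box_sum a w N - (\<Sum>k::int\<in>{0..<M}. card (cell_points M N k) * w (age_at a (of_int (k + 1) / of_int (M + 1))))\<bar>
    \<le> (\<Sum>j::int\<in>{0..<M}. \<bar>w (age_at a (of_int j / of_int M))\<bar>)"
proof -
  \<comment> \<open>The index of the half-open cell \<open>[k / M, (k + 1) / M)\<close> containing
    \<open>l / N\<close>.\<close>
  define g where "g l = (M * l) div N" for l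
  let ?f = "\<lambda>l::int. w (age_at a (l / N))"
  define I where "I = {l::int. l \<in> {0..<N} \<and> interior_param a (l / N)}"
  define I1 where "I1 = {l \<in> I. \<not> N dvd M * l}"
  define I2 where "I2 = {l \<in> I. N dvd M * l}"
  have fin: "finite I1" "finite I2"
    by (rule finite_subset[of _ "{0..<N}"]; force simp: I1_def I2_def I_def)+
  have g_range: "g l \<in> {0..<M}" if "l \<in> {0..<N}" for l
  proof -
    have "M * l < M * N" using that M by simp
    moreover have "g l * N + M * l mod N = M * l" by (simp add: g_def)
    moreover have "0 \<le> M * l mod N" using N by simp
    ultimately have "g l * N < M * N" by linarith
    then have "g l < M" using N by simp
    moreover have "g l \<ge> 0" using that M N by (simp add: g_def pos_imp_zdiv_nonneg_iff)
    ultimately show ?thesis by simp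
  qed
  have "box_sum a w N = sum ?f (I1 \<union> I2)"
    unfolding box_sum_def I1_def I2_def I_def by (rule sum.cong) auto
  also have "\<dots> = sum ?f I1 + sum ?f I2"
    by (rule sum.union_disjoint[OF fin]) (auto simp: I1_def I2_def)
  finally have split: "box_sum a w N = sum ?f I1 + sum ?f I2" .
  \<comment> \<open>Off the cell boundaries interiority is automatic, so each fibre of
    \<open>g\<close> on \<open>I1\<close> is a full cell.\<close>
  have g_eq: "{l \<in> I1. g l = k} = cell_points M N k" if k: "k \<in> {0..<M}" for k
  proof (intro equalityI subsetI)
    fix l assume l: "l \<in> {l \<in> I1. g l = k}"
    then have "M * l mod N \<noteq> 0" by (auto simp: I1_def dvd_eq_mod_eq_0)
    moreover have "M * l = k * N + M * l mod N" using l by (auto simp: g_def)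
    moreover have "0 \<le> M * l mod N" "M * l mod N < N" using N by simp_all
    ultimately show "l \<in> cell_points M N k"
      by (simp add: cell_points_def distrib_right)
  next
    fix l assume "l \<in> cell_points M N k"
    then have l: "k * N < M * l" "M * l < (k + 1) * N" by (simp_all add: cell_points_def)
    have "0 < M * l" using l(1) k N by (meson atLeastLessThan_iff le_less_trans less_imp_le mult_nonneg_nonneg)
    then have "0 < l" using M by (simp add: zero_less_mult_iff)
    have "(k + 1) * N \<le> M * N" using k N by (intro mult_right_mono) auto
    then have "M * l < M * N" using l(2) by linarith
    then have "l < N" using M by simp
    have g: "g l = k"
      unfolding g_def using l by (intro div_pos_neg_trivial int_div_pos_eq[of _ _ _ "M * l - k * N"]) (auto simp: algebra_simps)
    have nd: "\<not> N dvd M * l"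
    proof
      assume "N dvd M * l"
      then have "M * l = k * N" using g by (auto simp: g_def)
      then show False using l by simp
    qed
    have "real_of_int (M * l) / of_int N \<notin> \<int>"
      using nd N by (subst of_int_divide_Ints_iff) auto
    then have "interior_param a (l / N)" by (intro interior_paramI[OF dvd]) simp
    then show "l \<in> {l \<in> I1. g l = k}"
      using \<open>0 < l\<close> \<open>l < N\<close> g nd by (simp add: I1_def I_def)
  qed
  have f_cell: "?f l = w (age_at a (of_int (k + 1) / of_int (M + 1)))" if "l \<in> cell_points M N k" "k \<in> {0..<M}" for l k
  proof -
    have "real_of_int (k * N) < of_int (M * l)" "real_of_int (M * l) < of_int ((k + 1) * N)"
      using that unfolding of_int_less_iff cell_points_def by simp_all
    then have "k < M * (real_of_int l / N)" "M * (real_of_int l / N) < k + 1"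
      using N by (simp_all add: field_simps)
    \<comment> \<open>The representative lies in cell \<open>k\<close>: the first inequality amounts
      to \<open>k < M\<close>, the second to \<open>0 < k + 1\<close>.\<close>
    moreover have "k < M * (of_int (k + 1) / of_int (M + 1))" "M * (of_int (k + 1) / of_int (M + 1)) < k + 1"
      using that(2) M by (simp_all add: field_simps)
    ultimately have "age_at a (l / N) = age_at a (of_int (k + 1) / of_int (M + 1))"
      by (intro age_at_cell[OF dvd M])
    then show ?thesis by simp
  qed
  have "sum ?f I1 = (\<Sum>k::int\<in>{0..<M}. \<Sum>l\<in>{l \<in> I1. g l = k}. ?f l)"
    using fin g_range by (intro sum.group[symmetric]) (auto simp: I1_def I_def)
  also have "\<dots> = (\<Sum>k::int\<in>{0..<M}. \<Sum>l\<in>cell_points M N k. w (age_at a (of_int (k + 1) / of_int (M + 1))))"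
    using g_eq f_cell by (intro sum.cong) auto
  finally have s1: "sum ?f I1 = (\<Sum>k::int\<in>{0..<M}. card (cell_points M N k) * w (age_at a (of_int (k + 1) / of_int (M + 1))))"
    by simp
  \<comment> \<open>On boundary points the division is exact, so \<open>l / N = g l / M\<close> and
    \<open>g\<close> is injective there.\<close>
  have I2: "M * l = g l * N" if "l \<in> I2" for l
    using that by (simp add: I2_def g_def)
  have inj: "inj_on g I2"
    using I2 M by (intro inj_onI) (metis mult_cancel_left less_irrefl)
  have f2: "?f l = w (age_at a (of_int (g l) / of_int M))" if "l \<in> I2" for l
  proof -
    have "real_of_int (M * l) = of_int (g l * N)" using I2[OF that] by simp
    then have "real_of_int l / N = g l / M" using M N by (simp add: field_simps)
    then show ?thesis by simp
  qed
  have "\<bar>sum ?f I2\<bar> \<le> (\<Sum>l\<in>I2. \<bar>w (age_at a (of_int (g l) / of_int M))\<bar>)"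
    using f2 by (intro order_trans[OF sum_abs] eq_refl sum.cong) auto
  also have "\<dots> = (\<Sum>j\<in>g ` I2. \<bar>w (age_at a (of_int j / of_int M))\<bar>)"
    by (simp add: sum.reindex[OF inj])
  also have "\<dots> \<le> (\<Sum>j::int\<in>{0..<M}. \<bar>w (age_at a (of_int j / of_int M))\<bar>)"
    using g_range by (intro sum_mono2) (auto simp: I2_def I_def)
  finally show ?thesis using split s1 by simp
qed

section \<open>Passage to the limit\<close>

text \<open>Each cell count divided by \<open>n\<close> tends to \<open>1 / M\<close>, and the
  boundary error is a constant over \<open>n\<close>. The limit is the average of \<open>w\<close>
  over the cells, which the case \<open>N = M + 1\<close> computes exactly.\<close>

lemma box_sum_limit:
  assumes dvd: "\<forall>c\<in>set (weights a). c dvd M" and M: "M > 0"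
  shows "(\<lambda>n. box_sum a w (int n) / n) \<longlonglongrightarrow> box_sum a w (M + 1) / M"
proof -
  define e where "e k = w (age_at a (of_int (k + 1) / of_int (M + 1)))" for k :: int
  define R where "R = (\<Sum>j::int\<in>{0..<M}. \<bar>w (age_at a (of_int j / of_int M))\<bar>)"
  let ?main = "\<lambda>n::nat. \<Sum>k::int\<in>{0..<M}. card (cell_points M (int n) k) / n * e k"
  have "?main \<longlonglongrightarrow> (\<Sum>k::int\<in>{0..<M}. 1 / M * e k)"
    by (intro tendsto_sum tendsto_mult card_cell_points_limit[OF M] tendsto_const)
  moreover have "(\<lambda>n. box_sum a w (int n) / n - ?main n) \<longlonglongrightarrow> 0"
  proof (rule tendsto_0_le[where K = 1])
    show "\<forall>\<^sub>F n in sequentially. norm (box_sum a w (int n) / n - ?main n) \<le> norm (R / real n) * 1"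
    proof (rule eventually_mono[OF eventually_gt_at_top[of 0]])
      fix n :: nat assume n: "n > 0"
      have "?main n = (\<Sum>k::int\<in>{0..<M}. card (cell_points M (int n) k) * e k) / n"
        by (simp add: sum_divide_distrib)
      then have "box_sum a w (int n) / n - ?main n =
          (box_sum a w (int n) - (\<Sum>k::int\<in>{0..<M}. card (cell_points M (int n) k) * e k)) / n"
        by (simp add: diff_divide_distrib)
      then show "norm (box_sum a w (int n) / n - ?main n) \<le> norm (R / real n) * 1"
        using box_sum_cells[OF dvd M, where N = "int n" and w = w] n
        by (auto simp: e_def R_def intro!: divide_right_mono order_trans[OF _ abs_ge_self])
    qed
    show "(\<lambda>n. R / real n) \<longlonglongrightarrow> 0" by (rule lim_const_over_n)
  qed
  ultimately have "(\<lambda>n. ?main n + (box_sum a w (int n) / n - ?main n)) \<longlonglongrightarrow> (\<Sum>k::int\<in>{0..<M}. 1 / M * e k) + 0"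
    by (rule tendsto_add)
  then show ?thesis
    by (simp add: box_sum_Suc[OF dvd M] e_def sum_divide_distrib)
qed

lemma box_sum_ratio_limit:
  assumes dvd: "\<forall>c\<in>set (weights a). c dvd M" and M: "M > 0"
  shows "(\<lambda>n. box_sum a w (int n) / box_sum a (\<lambda>_. 1) (int n))
    \<longlonglongrightarrow> box_sum a w (M + 1) / box_sum a (\<lambda>_. 1) (M + 1)"
proof -
  \<comment> \<open>Hence the rescaled denominators tend to 1, and the quotient rule for limits
    applies.\<close>
  have one: "box_sum a (\<lambda>_. 1) (M + 1) = M"
    using M by (simp add: box_sum_Suc[OF dvd M])
  have "(\<lambda>n. (box_sum a w (int n) / n) / (box_sum a (\<lambda>_. 1) (int n) / n))
      \<longlonglongrightarrow> (box_sum a w (M + 1) / M) / (box_sum a (\<lambda>_. 1) (M + 1) / M)"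
    using M one by (intro tendsto_divide box_sum_limit[OF dvd M]) auto
  then have "(\<lambda>n. (box_sum a w (int n) / n) / (box_sum a (\<lambda>_. 1) (int n) / n))
      \<longlonglongrightarrow> box_sum a w (M + 1) / box_sum a (\<lambda>_. 1) (M + 1)"
    using M by simp
  then show ?thesis
    by (rule Lim_transform_eventually) (rule eventually_mono[OF eventually_gt_at_top[of 0]], simp)
qed

theorem theorem1p1:
  fixes a :: "int list" and M :: int
  assumes "\<forall>x\<in>set a. 1 \<le> x"
    and "M = Lcm (insert (-1 + sum_list a) (set a))"
  shows "(\<forall>i. (\<lambda>N::nat. coeff (distribution_poly (local_hstar (hnf_simplex a (int N)))) i)
               \<longlonglongrightarrow> coeff (distribution_poly (local_hstar (hnf_simplex a (M + 1)))) i) \<and>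
         (\<forall>z::real. (\<lambda>N::nat. poly (local_hstar (hnf_simplex a (int N))) z
                              / poly (local_hstar (hnf_simplex a (int N))) 1)
               \<longlonglongrightarrow> poly (local_hstar (hnf_simplex a (M + 1))) z
                              / poly (local_hstar (hnf_simplex a (M + 1))) 1)"
proof -
  have lim: "(\<lambda>n. box_sum a w (int n) / box_sum a (\<lambda>_. 1) (int n))
      \<longlonglongrightarrow> box_sum a w (M + 1) / box_sum a (\<lambda>_. 1) (M + 1)" for w
  proof (cases "-1 + sum_list a = 0")
    \<comment> \<open>A zero weight makes one coordinate integral for every \<open>t\<close>, so all
      sums vanish; both sides are \<open>0 / 0\<close>, which is 0 in HOL.\<close>
    case True
    then have "\<not> interior_param a t" for t
      by (simp add: interior_param_def weights_def)
    then have "box_sum a v N = 0" for v N by (simp add: box_sum_def)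
    then show ?thesis by simp
  next
    case False
    have "\<forall>c\<in>set (weights a). c dvd M"
      using assms(2) by (auto simp: weights_def)
    moreover have "M > 0"
    proof -
      have "0 \<notin> insert (-1 + sum_list a) (set a)" using assms(1) False by auto
      \<comment> \<open>The \<open>Lcm\<close> of a finite set is 0 only if the set contains
        0.\<close>
      then have "M \<noteq> 0" unfolding assms(2) by (subst Lcm_0_iff) auto
      moreover have "M \<ge> 0" unfolding assms(2) by (rule Lcm_int_greater_eq_0)
      ultimately show ?thesis by simp
    qed
    ultimately show ?thesis by (rule box_sum_ratio_limit)
  qed
  have "M \<ge> 0" unfolding assms(2) by (rule Lcm_int_greater_eq_0)
  then have M1: "M + 1 > 0" by simp
  have one: "poly (local_hstar (hnf_simplex a N)) 1 = box_sum a (\<lambda>_. 1) N" if "N > 0" for N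
    using poly_local_hstar[OF that, of a 1] by simp
  show ?thesis
  proof (intro conjI allI)
    fix i
    have eq: "coeff (distribution_poly (local_hstar (hnf_simplex a N))) i =
        box_sum a (\<lambda>j. of_bool (j = i)) N / box_sum a (\<lambda>_. 1) N" if "N > 0" for N
      using that by (simp add: distribution_poly_def coeff_local_hstar one)
    show "(\<lambda>N::nat. coeff (distribution_poly (local_hstar (hnf_simplex a (int N)))) i)
        \<longlonglongrightarrow> coeff (distribution_poly (local_hstar (hnf_simplex a (M + 1)))) i"
      \<comment> \<open>The formula \<open>eq\<close> is available for \<open>N > 0\<close>, which
        is enough for the limit.\<close>
      unfolding eq[OF M1]
      by (rule Lim_transform_eventually[OF lim])
         (rule eventually_mono[OF eventually_gt_at_top[of 0]], simp add: eq)
  next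
    fix z :: real
    have eq: "poly (local_hstar (hnf_simplex a N)) z / poly (local_hstar (hnf_simplex a N)) 1 =
        box_sum a (\<lambda>j. z ^ j) N / box_sum a (\<lambda>_. 1) N" if "N > 0" for N
      using that by (simp add: poly_local_hstar one)
    show "(\<lambda>N::nat. poly (local_hstar (hnf_simplex a (int N))) z
          / poly (local_hstar (hnf_simplex a (int N))) 1)
        \<longlonglongrightarrow> poly (local_hstar (hnf_simplex a (M + 1))) z
          / poly (local_hstar (hnf_simplex a (M + 1))) 1"
      unfolding eq[OF M1]
      by (rule Lim_transform_eventually[OF lim])
         (rule eventually_mono[OF eventually_gt_at_top[of 0]], simp add: eq)
  qed
qed

end
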